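(* Let $\lambda\in\mathbb{C}^*$, $\alpha\in\mathbb{C}$, $h(t)\in\mathbb{C}[t]$. Then the $\mathfrak{S}^0$-module $\Omega_{\mathfrak{S}^0}(\lambda,\alpha,h)$ is simple if and only if $\alpha\neq 0$.
   Context: All vector spaces are over $\mathbb{C}$. The Ramond type super-BMS$_3$ algebra $\mathfrak{S}^0$ is the Lie superalgebra with basis $\{L_m,W_m,G_m,C_1,C_2\mid m\in\mathbb{Z}\}$, where $L_m,W_m,C_1,C_2$ are even, the $G_m$ are odd, $C_1,C_2$ are central, and the non-trivial brackets are $$[L_m,L_n]=(n-m)L_{m+n}+\tfrac{n^3-n}{12}\delta_{m+n,0}C_1,\quad [L_m,W_n]=(n-m)W_{m+n}+\tfrac{n^3-n}{12}\delta_{m+n,0}C_2,$$ $$[L_m,G_r]=(r-\tfrac m2)G_{m+r},\quad [G_r,G_s]=2W_{r+s}+\tfrac13(r^2-\tfrac14)\delta_{r+s,0}C_2.$$ Modules over a Lie superalgebra (and their submodules) are $\mathbb{Z}_2$-graded, with $x(yv)-(-1)^{|x||y|}y(xv)=[x,y]v$ for homogeneous $x,y$. Simple means nonzero with no nonzero proper ($\mathbb{Z}_2$-graded) submodule. For $h(t)\in\mathbb{C}[t]$, $\alpha\in\mathbb{C}$ and $m\in\mathbb{Z}$, $h_m(t)=m\,h(t)-m(m-1)\alpha\,\frac{h(t)-h(\alpha)}{t-\alpha}\in\mathbb{C}[t]$. $\Omega_{\mathfrak{S}^0}(\lambda,\alpha,h)$ is the $\mathfrak{S}^0$-module with underlying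 space $V=\mathbb{C}[t^2,s]\oplus t\,\mathbb{C}[t^2,s]$, $V_{\bar 0}=\mathbb{C}[t^2,s]$, $V_{\bar 1}=t\,\mathbb{C}[t^2,s]$, and action (for $m\in\mathbb{Z}$, $f(t^2,s)\in\mathbb{C}[t^2,s]$; $\frac{\partial}{\partial t^2}$ is the partial derivative with respect to the variable $t^2$) $$L_m f(t^2,s)=\lambda^m(s+h_m(t^2))f(t^2,s-m)-m\lambda^m(t^2-m\alpha)\tfrac{\partial}{\partial t^2}(f(t^2,s-m)),$$ $$L_m\, tf(t^2,s)=\lambda^m(s-\tfrac m2+h_m(t^2))tf(t^2,s-m)-m\lambda^m(t^2-m\alpha)t\tfrac{\partial}{\partial t^2}f(t^2,s-m),$$ $$W_m f(t^2,s)=\lambda^m(t^2-m\alpha)f(t^2,s-m),\quad W_m\, tf(t^2,s)=\lambda^m(t^2-m\alpha)tf(t^2,s-m),$$ $$G_m f(t^2,s)=\lambda^m tf(t^2,s-m),\quad G_m\, tf(t^2,s)=\lambda^m(t^2-2m\alpha)f(t^2,s-m),$$ with $C_1,C_2$ acting as $0$. *)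

theory Defs
  imports
    Complex_Main
    "HOL-Library.Z2"
    "HOL-Library.Poly_Mapping"
    "HOL-Library.Product_Plus"
    "HOL-Computational_Algebra.Polynomial"
begin

section \<open>Lie superalgebras over the complex numbers and their modules\<close>

text \<open>
  Gradings are indexed by the two-element field \<^typ>\<open>bit\<close>: \<open>grade 0\<close> is the even part and
  \<open>grade 1\<close> the odd part.
\<close>

locale super_vector_space = vector_space scale
  for scale :: "complex \<Rightarrow> 'v::ab_group_add \<Rightarrow> 'v" +
  fixes grade :: "bit \<Rightarrow> 'v set"
  assumes subspace_grade: "subspace (grade p)"
    and grade_disjoint: "grade 0 \<inter> grade 1 = {0}"
    and grade_span: "\<exists>v0\<in>grade 0. \<exists>v1\<in>grade 1. v = v0 + v1"

definition koszul_sign :: "bit \<Rightarrow> bit \<Rightarrow> complex"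
  where "koszul_sign p q = (if p = 1 \<and> q = 1 then - 1 else 1)"

locale lie_superalgebra = super_vector_space scale grade
  for scale :: "complex \<Rightarrow> 'g::ab_group_add \<Rightarrow> 'g"
    and grade :: "bit \<Rightarrow> 'g set" +
  fixes bracket :: "'g \<Rightarrow> 'g \<Rightarrow> 'g"
  assumes linear_bracket_left: "Vector_Spaces.linear scale scale (\<lambda>x. bracket x y)"
    and linear_bracket_right: "Vector_Spaces.linear scale scale (bracket x)"
    and bracket_grade: "x \<in> grade p \<Longrightarrow> y \<in> grade q \<Longrightarrow> bracket x y \<in> grade (p + q)"
    and super_skew_symmetric: "x \<in> grade p \<Longrightarrow> y \<in> grade q \<Longrightarrow>
      bracket x y = - scale (koszul_sign p q) (bracket y x)"
    and super_Jacobi: "x \<in> grade p \<Longrightarrow> y \<in> grade q \<Longrightarrow> z \<in> grade r \<Longrightarrow>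
      bracket x (bracket y z) =
        bracket (bracket x y) z + scale (koszul_sign p q) (bracket y (bracket x z))"

locale lie_supermodule =
  lie_superalgebra scaleg gradeg bracket + V: super_vector_space scale grade
  for scaleg :: "complex \<Rightarrow> 'g::ab_group_add \<Rightarrow> 'g"
    and gradeg :: "bit \<Rightarrow> 'g set"
    and bracket :: "'g \<Rightarrow> 'g \<Rightarrow> 'g"
    and scale :: "complex \<Rightarrow> 'v::ab_group_add \<Rightarrow> 'v"
    and grade :: "bit \<Rightarrow> 'v set" +
  fixes act :: "'g \<Rightarrow> 'v \<Rightarrow> 'v"
  assumes linear_act_left: "Vector_Spaces.linear scaleg scale (\<lambda>x. act x v)"
    and linear_act_right: "Vector_Spaces.linear scale scale (act x)"
    and act_grade: "x \<in> gradeg p \<Longrightarrow> v \<in> grade q \<Longrightarrow> act x v \<in> grade (p + q)"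
    and act_bracket: "x \<in> gradeg p \<Longrightarrow> y \<in> gradeg q \<Longrightarrow>
      act x (act y v) - scale (koszul_sign p q) (act y (act x v)) = act (bracket x y) v"
begin

definition submodule :: "'v set \<Rightarrow> bool"
  where "submodule U \<longleftrightarrow> V.subspace U \<and> (\<forall>x. \<forall>u\<in>U. act x u \<in> U) \<and>
    (\<forall>u\<in>U. \<exists>u0\<in>U \<inter> grade 0. \<exists>u1\<in>U \<inter> grade 1. u = u0 + u1)"

end

locale simple_lie_supermodule = lie_supermodule scaleg gradeg bracket scale grade act
  for scaleg :: "complex \<Rightarrow> 'g::ab_group_add \<Rightarrow> 'g"
    and gradeg :: "bit \<Rightarrow> 'g set"
    and bracket :: "'g \<Rightarrow> 'g \<Rightarrow> 'g"
    and scale :: "complex \<Rightarrow> 'v::ab_group_add \<Rightarrow> 'v"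
    and grade :: "bit \<Rightarrow> 'v set"
    and act :: "'g \<Rightarrow> 'v \<Rightarrow> 'v" +
  assumes nonzero: "\<exists>v::'v. v \<noteq> 0"
    and no_proper_submodule: "submodule U \<Longrightarrow> U = {0} \<or> U = UNIV"


section \<open>The Ramond type super-BMS3 algebra\<close>

datatype sbms_basis = L int | W int | G int | C1 | C2

type_synonym sbms = "sbms_basis \<Rightarrow>\<^sub>0 complex"

fun parity :: "sbms_basis \<Rightarrow> bit" where
  "parity (G r) = 1"
| "parity _ = 0"

definition sbms_scale :: "complex \<Rightarrow> sbms \<Rightarrow> sbms"
  where "sbms_scale c = Poly_Mapping.map ((*) c)"

definition sbms_grade :: "bit \<Rightarrow> sbms set"
  where "sbms_grade p = {x. \<forall>b\<in>Poly_Mapping.keys x. parity b = p}"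

fun basis_bracket :: "sbms_basis \<Rightarrow> sbms_basis \<Rightarrow> sbms" where
  "basis_bracket (L m) (L n) =
     Poly_Mapping.single (L (m + n)) (of_int (n - m))
     + Poly_Mapping.single C1 (if m + n = 0 then of_int (n ^ 3 - n) / 12 else 0)"
| "basis_bracket (L m) (W n) =
     Poly_Mapping.single (W (m + n)) (of_int (n - m))
     + Poly_Mapping.single C2 (if m + n = 0 then of_int (n ^ 3 - n) / 12 else 0)"
| "basis_bracket (W n) (L m) =
     - (Poly_Mapping.single (W (m + n)) (of_int (n - m))
        + Poly_Mapping.single C2 (if m + n = 0 then of_int (n ^ 3 - n) / 12 else 0))"
| "basis_bracket (L m) (G r) =
     Poly_Mapping.single (G (m + r)) (of_int r - of_int m / 2)"
| "basis_bracket (G r) (L m) =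
     - Poly_Mapping.single (G (m + r)) (of_int r - of_int m / 2)"
| "basis_bracket (G r) (G s) =
     Poly_Mapping.single (W (r + s)) 2
     + Poly_Mapping.single C2 (if r + s = 0 then (of_int r ^ 2 - 1 / 4) / 3 else 0)"
| "basis_bracket _ _ = 0"

definition sbms_bracket :: "sbms \<Rightarrow> sbms \<Rightarrow> sbms"
  where "sbms_bracket x y = (\<Sum>a\<in>Poly_Mapping.keys x. \<Sum>b\<in>Poly_Mapping.keys y.
    sbms_scale (Poly_Mapping.lookup x a * Poly_Mapping.lookup y b) (basis_bracket a b))"


section \<open>The modules \<open>\<Omega>(\<lambda>, \<alpha>, h)\<close>\<close>

text \<open>
  A polynomial \<open>f(t\<^sup>2, s)\<close> is an element of \<open>\<complex>[t\<^sup>2][s]\<close>: the outer variable of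
  \<^typ>\<open>complex poly poly\<close> is \<open>s\<close>, the inner one is \<open>t\<^sup>2\<close>.
  The pair \<open>(f, g)\<close> stands for \<open>f(t\<^sup>2, s) + t g(t\<^sup>2, s)\<close>; see \<open>bij_omega_poly\<close> below.
\<close>

type_synonym omega = "complex poly poly \<times> complex poly poly"

fun omega_scale :: "complex \<Rightarrow> omega \<Rightarrow> omega"
  where "omega_scale c (f, g) = (smult [:c:] f, smult [:c:] g)"

definition omega_grade :: "bit \<Rightarrow> omega set"
  where "omega_grade p = (if p = 0 then {(f, 0) | f. True} else {(0, g) | g. True})"

abbreviation s_var :: "complex poly poly" where "s_var \<equiv> [:0, 1:]"

abbreviation in_t2 :: "complex poly \<Rightarrow> complex poly poly" where "in_t2 p \<equiv> [:p:]"

abbreviation t2_var :: "complex poly" where "t2_var \<equiv> [:0, 1:]"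

definition shift :: "int \<Rightarrow> complex poly poly \<Rightarrow> complex poly poly"
  where "shift m f = pcompose f [:- of_int m, 1:]"

definition deriv_t2 :: "complex poly poly \<Rightarrow> complex poly poly"
  where "deriv_t2 = map_poly pderiv"

text \<open>The division is exact, since \<open>\<alpha>\<close> is a root of \<open>h - h(\<alpha>)\<close>.\<close>

definition h_poly :: "complex \<Rightarrow> complex poly \<Rightarrow> int \<Rightarrow> complex poly"
  where "h_poly \<alpha> h m = smult (of_int m) h
    - smult (of_int (m * (m - 1)) * \<alpha>) ((h - [:poly h \<alpha>:]) div [:- \<alpha>, 1:])"

fun basis_act :: "complex \<Rightarrow> complex \<Rightarrow> complex poly \<Rightarrow> sbms_basis \<Rightarrow> omega \<Rightarrow> omega" where
  "basis_act lam \<alpha> h (L m) (f, g) = omega_scale (lam powi m)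
     ((s_var + in_t2 (h_poly \<alpha> h m)) * shift m f
        - in_t2 (smult (of_int m) (t2_var - [:of_int m * \<alpha>:])) * deriv_t2 (shift m f),
      (s_var - in_t2 [:of_int m / 2:] + in_t2 (h_poly \<alpha> h m)) * shift m g
        - in_t2 (smult (of_int m) (t2_var - [:of_int m * \<alpha>:])) * deriv_t2 (shift m g))"
| "basis_act lam \<alpha> h (W m) (f, g) = omega_scale (lam powi m)
     (in_t2 (t2_var - [:of_int m * \<alpha>:]) * shift m f,
      in_t2 (t2_var - [:of_int m * \<alpha>:]) * shift m g)"
| "basis_act lam \<alpha> h (G m) (f, g) = omega_scale (lam powi m)
     (in_t2 (t2_var - [:2 * of_int m * \<alpha>:]) * shift m g, shift m f)"
| "basis_act lam \<alpha> h C1 v = 0"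
| "basis_act lam \<alpha> h C2 v = 0"

definition omega_act :: "complex \<Rightarrow> complex \<Rightarrow> complex poly \<Rightarrow> sbms \<Rightarrow> omega \<Rightarrow> omega"
  where "omega_act lam \<alpha> h x v = (\<Sum>b\<in>Poly_Mapping.keys x.
    omega_scale (Poly_Mapping.lookup x b) (basis_act lam \<alpha> h b v))"


section \<open>These data form a Lie superalgebra and a module over it\<close>

lemma lookup_sbms_scale [simp]:
  "Poly_Mapping.lookup (sbms_scale c x) b = c * Poly_Mapping.lookup x b"
  by (simp add: sbms_scale_def map.rep_eq when_def)

lemma vector_space_sbms: "vector_space sbms_scale"
  by unfold_locales (auto intro!: poly_mapping_eqI simp: lookup_add algebra_simps)

interpretation sbms: vector_space sbms_scale by (rule vector_space_sbms)

lemma vector_space_omega: "vector_space omega_scale"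
  by unfold_locales
    (auto simp: plus_prod_def smult_add_right mult.commute simp flip: smult_add_left one_pCons)

interpretation omega: vector_space omega_scale by (rule vector_space_omega)

lemma keys_sbms_scale: "Poly_Mapping.keys (sbms_scale c x) \<subseteq> Poly_Mapping.keys x"
  by (auto simp: in_keys_iff)

lemma lift_expand:
  assumes "vector_space s" "finite A" "Poly_Mapping.keys x \<subseteq> A"
  shows "(\<Sum>a\<in>Poly_Mapping.keys x. s (Poly_Mapping.lookup x a) (F a)) =
    (\<Sum>a\<in>A. s (Poly_Mapping.lookup x a) (F a))"
proof -
  interpret vector_space s by fact
  show ?thesis using assms by (intro sum.mono_neutral_left) (auto simp: in_keys_iff)
qed

lemma linear_lift:
  assumes "vector_space s"
  shows "Vector_Spaces.linear sbms_scale s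
    (\<lambda>x. \<Sum>a\<in>Poly_Mapping.keys x. s (Poly_Mapping.lookup x a) (F a))"
proof -
  interpret vector_space s by fact
  have add: "(\<Sum>a\<in>Poly_Mapping.keys (x + y). s (Poly_Mapping.lookup (x + y) a) (F a)) =
      (\<Sum>a\<in>Poly_Mapping.keys x. s (Poly_Mapping.lookup x a) (F a)) +
      (\<Sum>a\<in>Poly_Mapping.keys y. s (Poly_Mapping.lookup y a) (F a))"
    for x y :: sbms
    using keys_add[of x y]
    by (subst (1 2 3) lift_expand[OF assms, where A = "Poly_Mapping.keys x \<union> Poly_Mapping.keys y"])
      (auto simp: sum.distrib lookup_add scale_left_distrib)
  have scale: "(\<Sum>a\<in>Poly_Mapping.keys (sbms_scale c x).
      s (Poly_Mapping.lookup (sbms_scale c x) a) (F a)) =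
      s c (\<Sum>a\<in>Poly_Mapping.keys x. s (Poly_Mapping.lookup x a) (F a))" for c x
    using keys_sbms_scale[of c x]
    by (subst lift_expand[OF assms, where A = "Poly_Mapping.keys x"]) (auto simp: scale_sum_right)
  show ?thesis
    unfolding Vector_Spaces.linear_iff using assms vector_space_sbms add scale by blast
qed

lemma sbms_induct [consumes 1, case_names zero single add]:
  assumes "x \<in> sbms_grade p" "P 0"
    and "\<And>b c. parity b = p \<Longrightarrow> P (sbms_scale c (Poly_Mapping.single b 1))"
    and "\<And>x y. P x \<Longrightarrow> P y \<Longrightarrow> P (x + y)"
  shows "P x"
proof -
  have eq: "x = (\<Sum>b\<in>Poly_Mapping.keys x.
      sbms_scale (Poly_Mapping.lookup x b) (Poly_Mapping.single b 1))"
    by (rule poly_mapping_eqI)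
      (simp add: lookup_sum lookup_single when_def in_keys_iff if_distrib [where f = "(*) _"]
        cong: if_cong)
  have "P (\<Sum>b\<in>A. sbms_scale (Poly_Mapping.lookup x b) (Poly_Mapping.single b 1))"
    if "finite A" "A \<subseteq> Poly_Mapping.keys x" for A
    using that assms by (induction A rule: finite_induct) (auto simp: sbms_grade_def)
  then show ?thesis using eq by (metis finite_keys order_refl)
qed

abbreviation basis_elt :: "sbms_basis \<Rightarrow> sbms" where "basis_elt b \<equiv> Poly_Mapping.single b 1"

lemma bracket_left: "Vector_Spaces.linear sbms_scale sbms_scale (\<lambda>x. sbms_bracket x y)"
proof -
  have "sbms_bracket x y = (\<Sum>a\<in>Poly_Mapping.keys x. sbms_scale (Poly_Mapping.lookup x a)
      (\<Sum>b\<in>Poly_Mapping.keys y. sbms_scale (Poly_Mapping.lookup y b) (basis_bracket a b)))" for x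
    by (simp add: sbms_bracket_def sbms.scale_sum_right)
  then show ?thesis using linear_lift[OF vector_space_sbms] by simp
qed

lemma bracket_right: "Vector_Spaces.linear sbms_scale sbms_scale (sbms_bracket x)"
proof -
  have "sbms_bracket x y = (\<Sum>b\<in>Poly_Mapping.keys y. sbms_scale (Poly_Mapping.lookup y b)
      (\<Sum>a\<in>Poly_Mapping.keys x. sbms_scale (Poly_Mapping.lookup x a) (basis_bracket a b)))" for y
    unfolding sbms_bracket_def
    by (subst sum.swap) (simp add: sbms.scale_sum_right mult.commute)
  then have "sbms_bracket x = (\<lambda>y. \<Sum>b\<in>Poly_Mapping.keys y. sbms_scale (Poly_Mapping.lookup y b)
      (\<Sum>a\<in>Poly_Mapping.keys x. sbms_scale (Poly_Mapping.lookup x a) (basis_bracket a b)))" by blast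
  then show ?thesis using linear_lift[OF vector_space_sbms] by simp
qed

lemmas bracket_linear =
  module_hom.add[OF bracket_left[unfolded linear_iff_module_hom]]
  module_hom.add[OF bracket_right[unfolded linear_iff_module_hom]]
  module_hom.scale[OF bracket_left[unfolded linear_iff_module_hom]]
  module_hom.scale[OF bracket_right[unfolded linear_iff_module_hom]]
  module_hom.zero[OF bracket_left[unfolded linear_iff_module_hom]]
  module_hom.zero[OF bracket_right[unfolded linear_iff_module_hom]]
  module_hom.diff[OF bracket_left[unfolded linear_iff_module_hom]]
  module_hom.diff[OF bracket_right[unfolded linear_iff_module_hom]]
  module_hom.neg[OF bracket_left[unfolded linear_iff_module_hom]]
  module_hom.neg[OF bracket_right[unfolded linear_iff_module_hom]]

lemma single_eq_basis: "Poly_Mapping.single b c = sbms_scale c (basis_elt b)"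
  by (rule poly_mapping_eqI) (simp add: lookup_single when_def)

lemma bracket_basis: "sbms_bracket (basis_elt a) (basis_elt b) = basis_bracket a b"
  by (simp add: sbms_bracket_def)

lemma basis_bracket_grade:
  "basis_bracket a b \<in> sbms_grade (parity a + parity b)"
  by (cases "(a, b)" rule: basis_bracket.cases)
    (auto simp: sbms_grade_def in_keys_iff lookup_add lookup_minus lookup_single when_def
      split: if_splits)

lemma skew_basis:
  "basis_bracket a b = - sbms_scale (koszul_sign (parity a) (parity b)) (basis_bracket b a)"
proof (rule poly_mapping_eqI)
  fix k
  show "Poly_Mapping.lookup (basis_bracket a b) k = Poly_Mapping.lookup
      (- sbms_scale (koszul_sign (parity a) (parity b)) (basis_bracket b a)) k"
    by (cases "(a, b)" rule: basis_bracket.cases)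
     (auto simp: koszul_sign_def lookup_add lookup_minus lookup_single when_def add.commute field_simps
        add_eq_0_iff2)
qed

lemma solve_sum_zero: "x + y = - z \<Longrightarrow> x = - y - z" for x y z :: int
  by simp

lemma Jacobi_basis:
  "sbms_bracket (basis_elt a) (basis_bracket b c) =
   sbms_bracket (basis_bracket a b) (basis_elt c) +
   sbms_scale (koszul_sign (parity a) (parity b)) (sbms_bracket (basis_elt b) (basis_bracket a c))"
  by (cases a; cases b; cases c;
      simp add: single_eq_basis [where c = "of_int _"] single_eq_basis [where c = "If _ _ _"]
        single_eq_basis [where c = "_ - _"] single_eq_basis [where c = "numeral _"]
        single_eq_basis [where c = "_ / _"] bracket_linear bracket_basis koszul_sign_def;
      safe intro!: poly_mapping_eqI;
      auto simp: lookup_add lookup_minus lookup_single when_def add_eq_0_iff2 algebra_simps;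
      auto dest!: solve_sum_zero simp: field_simps power2_eq_square power3_eq_cube)

lemma super_vector_space_sbms: "super_vector_space sbms_scale sbms_grade"
proof
  show "sbms.subspace (sbms_grade p)" for p
    by (rule sbms.subspaceI)
      (auto simp: sbms_grade_def in_keys_iff lookup_add)
  show "sbms_grade 0 \<inter> sbms_grade 1 = {0}"
    by (auto simp: sbms_grade_def)
  fix v :: sbms
  let ?part = "\<lambda>p. Poly_Mapping.mapp (\<lambda>b c. c when parity b = p) v"
  have "?part p \<in> sbms_grade p" for p
    by (auto simp: sbms_grade_def in_keys_iff mapp.rep_eq when_def split: if_splits)
  moreover have "v = ?part 0 + ?part 1"
    by (rule poly_mapping_eqI) (auto simp: lookup_add mapp.rep_eq when_def in_keys_iff)
  ultimately show "\<exists>v0\<in>sbms_grade 0. \<exists>v1\<in>sbms_grade 1. v = v0 + v1"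
    by blast
qed

interpretation sbms: super_vector_space sbms_scale sbms_grade
  by (rule super_vector_space_sbms)

theorem lie_superalgebra_sbms: "lie_superalgebra sbms_scale sbms_grade sbms_bracket"
proof (intro lie_superalgebra.intro lie_superalgebra_axioms.intro super_vector_space_sbms)
  show "Vector_Spaces.linear sbms_scale sbms_scale (\<lambda>x. sbms_bracket x y)" for y
    by (rule bracket_left)
  show "Vector_Spaces.linear sbms_scale sbms_scale (sbms_bracket x)" for x
    by (rule bracket_right)
  show "sbms_bracket x y \<in> sbms_grade (p + q)"
    if x: "x \<in> sbms_grade p" and y: "y \<in> sbms_grade q" for x y p q
    using x
  proof (induction x rule: sbms_induct)
    case (single a c)
    from y show ?case
    proof (induction y rule: sbms_induct)
      case (single b d)
      then show ?case
        using basis_bracket_grade[of a b] \<open>parity a = p\<close>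
        by (auto simp: bracket_linear bracket_basis intro!: sbms.subspace_scale sbms.subspace_grade)
    qed (auto simp: bracket_linear sbms.subspace_0 sbms.subspace_add sbms.subspace_grade
        sbms.scale_right_distrib)
  qed (auto simp: bracket_linear sbms.subspace_0 sbms.subspace_add sbms.subspace_grade)
  show "sbms_bracket x y = - sbms_scale (koszul_sign p q) (sbms_bracket y x)"
    if x: "x \<in> sbms_grade p" and y: "y \<in> sbms_grade q" for x y p q
    using x
  proof (induction x rule: sbms_induct)
    case (single a c)
    from y show ?case
    proof (induction y rule: sbms_induct)
      case (single b d)
      then show ?case
        using skew_basis[of a b] \<open>parity a = p\<close>
        by (simp add: bracket_linear bracket_basis mult_ac)
    qed (auto simp: bracket_linear sbms.scale_right_distrib)
  qed (auto simp: bracket_linear sbms.scale_right_distrib)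
  show "sbms_bracket x (sbms_bracket y z) = sbms_bracket (sbms_bracket x y) z
      + sbms_scale (koszul_sign p q) (sbms_bracket y (sbms_bracket x z))"
    if x: "x \<in> sbms_grade p" and y: "y \<in> sbms_grade q" and z: "z \<in> sbms_grade r"
    for x y z p q r
    using x
  proof (induction x rule: sbms_induct)
    case (single a c)
    from y show ?case
    proof (induction y rule: sbms_induct)
      case (single b d)
      from z show ?case
      proof (induction z rule: sbms_induct)
        case (single k e)
        then show ?case
          using Jacobi_basis[of a b k] \<open>parity a = p\<close> \<open>parity b = q\<close>
          by (simp add: bracket_linear bracket_basis mult_ac sbms.scale_right_distrib)
      qed (auto simp: bracket_linear sbms.scale_right_distrib)
    qed (auto simp: bracket_linear sbms.scale_right_distrib)
  qed (auto simp: bracket_linear sbms.scale_right_distrib)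
qed

lemma shift_simps [simp]:
  "shift m (f + g) = shift m f + shift m g"
  "shift m (f - g) = shift m f - shift m g"
  "shift m (f * g) = shift m f * shift m g"
  "shift m 0 = 0"
  "shift m (in_t2 p) = in_t2 p"
  "shift m s_var = s_var - of_int m"
  "shift m (of_int k) = of_int k"
  by (simp_all add: shift_def pcompose_add pcompose_diff pcompose_mult pcompose_pCons of_int_poly)

lemma shift_shift [simp]: "shift m (shift n f) = shift (m + n) f"
  by (simp add: shift_def pcompose_pCons add.commute flip: pcompose_assoc)

lemma coeff_deriv_t2: "coeff (deriv_t2 f) n = pderiv (coeff f n)"
  by (simp add: deriv_t2_def coeff_map_poly)

lemma pderiv_sum: "pderiv (sum f A) = (\<Sum>i\<in>A. pderiv (f i))"
  by (induction A rule: infinite_finite_induct) (simp_all add: pderiv_add)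

lemma deriv_t2_simps [simp]:
  "deriv_t2 (f + g) = deriv_t2 f + deriv_t2 g"
  "deriv_t2 (f - g) = deriv_t2 f - deriv_t2 g"
  "deriv_t2 (f * g) = deriv_t2 f * g + f * deriv_t2 g"
  "deriv_t2 0 = 0"
  "deriv_t2 (in_t2 p) = in_t2 (pderiv p)"
  "deriv_t2 s_var = 0"
  "deriv_t2 (of_int k) = 0"
proof -
  show "deriv_t2 (f * g) = deriv_t2 f * g + f * deriv_t2 g"
    by (rule poly_eqI)
      (simp add: coeff_deriv_t2 coeff_mult pderiv_sum pderiv_mult sum.distrib
        mult.commute [of "coeff g _"])
  show "deriv_t2 (of_int k) = 0"
    by (simp add: of_int_poly deriv_t2_def map_poly_pCons pderiv_pCons)
qed (rule poly_eqI; simp add: coeff_deriv_t2 pderiv_add pderiv_diff pderiv_pCons coeff_pCons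
    split: nat.split)+

lemma shift_deriv_t2: "shift m (deriv_t2 f) = deriv_t2 (shift m f)"
proof (induction f)
  case (pCons a f)
  have "pCons a f = in_t2 a + s_var * f" by simp
  then show ?case by (simp only: shift_simps deriv_t2_simps pCons) simp
qed simp


lemma super_vector_space_omega: "super_vector_space omega_scale omega_grade"
proof
  show "omega.subspace (omega_grade p)" for p
    by (rule omega.subspaceI) (auto simp: omega_grade_def zero_prod_def split: if_splits)
  show "omega_grade 0 \<inter> omega_grade 1 = {0}"
    by (auto simp: omega_grade_def zero_prod_def)
  show "\<exists>v0\<in>omega_grade 0. \<exists>v1\<in>omega_grade 1. v = v0 + v1" for v
    by (cases v) (auto simp: omega_grade_def)
qed

interpretation omega: super_vector_space omega_scale omega_grade
  by (rule super_vector_space_omega)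

lemma h_poly_identity:
  fixes \<alpha> :: complex and h :: "complex poly" and m n :: int
  defines "H \<equiv> h_poly \<alpha> h" and "X \<equiv> [:0, 1:]" and "A \<equiv> [:\<alpha>:]"
  shows "of_int n * H n - of_int m * H m - of_int m * (X - of_int m * A) * pderiv (H n)
     + of_int n * (X - of_int n * A) * pderiv (H m) = of_int (n - m) * H (m + n)"
proof -
  define q where "q = (h - [:poly h \<alpha>:]) div [:- \<alpha>, 1:]"
  define B where "B = [:poly h \<alpha>:]"
  have XA: "[:- \<alpha>, 1:] = X - A" by (simp add: X_def A_def)
  have "[:- \<alpha>, 1:] dvd h - B"
    by (simp add: B_def flip: poly_eq_0_iff_dvd)
  then have h: "h = B + (X - A) * q"
    unfolding q_def B_def XA [symmetric]
    by (simp only: dvd_mult_div_cancel add_diff_eq add_diff_cancel_left')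
  have d: "pderiv X = 1" "pderiv A = 0" "pderiv B = 0"
    by (simp_all add: X_def A_def B_def pderiv_pCons one_pCons)
  have smult: "smult (of_int k) p = of_int k * p" "smult (of_int k * \<alpha>) p = of_int k * A * p"
    for k and p :: "complex poly"
    by (simp_all add: A_def of_int_poly mult.commute)
  have H: "H k = of_int k * h - of_int (k * (k - 1)) * A * q" for k
    unfolding H_def h_poly_def q_def smult ..
  have dH: "pderiv (H k) = of_int k * (q + (X - A) * pderiv q)
      - of_int (k * (k - 1)) * A * pderiv q" for k
  proof -
    have [simp]: "pderiv (of_int j :: complex poly) = 0" for j
      by (simp add: of_int_poly pderiv_pCons)
    then show ?thesis
      unfolding H by (subst h)
        (simp add: pderiv_mult pderiv_diff pderiv_add d mult.assoc algebra_simps del: of_int_mult)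
  qed
  show ?thesis
    unfolding dH unfolding H unfolding h by (simp add: algebra_simps)
qed

lemma Witt_identity:
  fixes s hm hn hm' hn' hk x F D E m n a :: "'a::comm_ring_1"
  assumes "n * hn - m * hm - m * (x - m * a) * hn' + n * (x - n * a) * hm' = (n - m) * hk"
  shows "(s + hm) * ((s - m + hn) * F - n * (x - n * a) * D)
       - m * (x - m * a) * (hn' * F + (s - m + hn) * D - n * D - n * (x - n * a) * E)
     - ((s + hn) * ((s - n + hm) * F - m * (x - m * a) * D)
       - n * (x - n * a) * (hm' * F + (s - n + hm) * D - m * D - m * (x - m * a) * E))
     = (n - m) * ((s + hk) * F - (m + n) * (x - (m + n) * a) * D)"
proof -
  have "(n - m) * ((s + hk) * F - (m + n) * (x - (m + n) * a) * D)
      = (n - m) * s * F + ((n - m) * hk) * F - (n - m) * (m + n) * (x - (m + n) * a) * D"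
    by (simp add: algebra_simps)
  then show ?thesis
    unfolding assms [symmetric] by (simp add: algebra_simps)
qed


definition L_op :: "complex \<Rightarrow> complex poly \<Rightarrow> int \<Rightarrow> complex poly poly \<Rightarrow> complex poly poly"
  where "L_op \<alpha> p m f = (s_var + in_t2 p) * shift m f
    - of_int m * (in_t2 t2_var - of_int m * in_t2 [:\<alpha>:]) * deriv_t2 (shift m f)"

lemma in_t2_simps:
  "in_t2 (p + q) = in_t2 p + in_t2 q"
  "in_t2 (p - q) = in_t2 p - in_t2 q"
  "in_t2 (p * q) = in_t2 p * in_t2 q"
  "in_t2 (of_int k) = of_int k"
  by (simp_all add: of_int_poly)

lemma smult_const: "smult (of_int k) p = of_int k * p" for p :: "complex poly"
  by (simp add: of_int_poly)

lemma const_simps: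
  "[:of_int k * c:] = of_int k * [:c:]" "[:2 * of_int k * c:] = 2 * of_int k * [:c:]"
  "[:(of_int k :: complex) / 2:] = of_int k * [:1 / 2:]" for c :: complex
  by (simp_all add: of_int_poly numeral_poly mult.commute)

lemma L_op_smult [simp]: "L_op \<alpha> p m (smult [:c:] f) = smult [:c:] (L_op \<alpha> p m f)"
proof -
  have *: "smult [:c:] g = in_t2 [:c:] * g" for g by simp
  show ?thesis
    unfolding * L_op_def by (simp add: pderiv_pCons algebra_simps del: mult_pCons_left mult_pCons_right)
qed

lemma shift_smult [simp]: "shift m (smult p f) = smult p (shift m f)"
  by (simp add: shift_def pcompose_smult)

lemma L_op_shift:
  "shift n (L_op \<alpha> p m f) = (s_var - of_int n + in_t2 p) * shift (m + n) f
    - of_int m * (in_t2 t2_var - of_int m * in_t2 [:\<alpha>:]) * deriv_t2 (shift (m + n) f)"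
  unfolding L_op_def shift_simps shift_deriv_t2 shift_shift by (simp add: add.commute)

lemma L_op_L_op:
  assumes "of_int n * pn - of_int m * pm
      - of_int m * (t2_var - of_int m * [:\<alpha>:]) * pderiv pn
      + of_int n * (t2_var - of_int n * [:\<alpha>:]) * pderiv pm = of_int (n - m) * pk"
  shows "L_op \<alpha> pm m (L_op \<alpha> pn n f) - L_op \<alpha> pn n (L_op \<alpha> pm m f)
    = of_int (n - m) * L_op \<alpha> pk (m + n) f"
proof -
  define X where "X = in_t2 t2_var"
  define A where "A = in_t2 [:\<alpha>:]"
  define F where "F = shift (m + n) f"
  define S where "S = s_var"
  define Pm Pn Pk Pm' Pn' where "Pm = in_t2 pm" and "Pn = in_t2 pn" and "Pk = in_t2 pk"
    and "Pm' = in_t2 (pderiv pm)" and "Pn' = in_t2 (pderiv pn)"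
  note defs = X_def A_def S_def Pm_def Pn_def Pk_def Pm'_def Pn'_def
  have deriv: "deriv_t2 X = 1" "deriv_t2 A = 0" "deriv_t2 S = 0" "deriv_t2 Pm = Pm'"
      "deriv_t2 Pn = Pn'"
    unfolding defs deriv_t2_simps by (simp_all add: pderiv_pCons one_pCons)
  have F: "shift (n + m) f = F" "shift (m + n) f = F"
    by (simp_all add: F_def add.commute)
  have key: "of_int n * Pn - of_int m * Pm - of_int m * (X - of_int m * A) * Pn'
      + of_int n * (X - of_int n * A) * Pm' = (of_int n - of_int m) * Pk"
    using arg_cong [OF assms, of in_t2] unfolding in_t2_simps defs of_int_diff .
  show ?thesis
    using Witt_identity [OF key, of S F "deriv_t2 F" "deriv_t2 (deriv_t2 F)"]
    unfolding L_op_def [of _ _ _ "L_op _ _ _ _"] L_op_shift L_op_def [of _ _ "m + n"]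
      F defs [symmetric] of_int_diff of_int_add
    by (simp add: deriv algebra_simps)
qed

lemma basis_act_simps:
  "basis_act lam \<alpha> h (L m) (f, g) = omega_scale (lam powi m)
     (L_op \<alpha> (h_poly \<alpha> h m) m f, L_op \<alpha> (h_poly \<alpha> h m - of_int m * [:1 / 2:]) m g)"
  "basis_act lam \<alpha> h (W m) (f, g) = omega_scale (lam powi m)
     ((in_t2 t2_var - of_int m * in_t2 [:\<alpha>:]) * shift m f,
      (in_t2 t2_var - of_int m * in_t2 [:\<alpha>:]) * shift m g)"
  "basis_act lam \<alpha> h (G m) (f, g) = omega_scale (lam powi m)
     ((in_t2 t2_var - 2 * of_int m * in_t2 [:\<alpha>:]) * shift m g, shift m f)"
  unfolding basis_act.simps const_simps smult_const in_t2_simps L_op_def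
  by (simp_all add: algebra_simps in_t2_simps numeral_poly)


lemma basis_act_linear: "Vector_Spaces.linear omega_scale omega_scale (basis_act lam \<alpha> h b)"
proof -
  have "basis_act lam \<alpha> h b (v + w) = basis_act lam \<alpha> h b v + basis_act lam \<alpha> h b w" for v w
    by (cases b; cases v; cases w)
      (simp_all add: basis_act_simps L_op_def algebra_simps smult_add_right smult_diff_right
        del: basis_act.simps(1-3))
  moreover have "basis_act lam \<alpha> h b (omega_scale c v) = omega_scale c (basis_act lam \<alpha> h b v)"
    for c v
    by (cases b; cases v) (simp_all add: basis_act_simps mult.commute del: basis_act.simps(1-3))
  ultimately show ?thesis
    unfolding Vector_Spaces.linear_iff using vector_space_omega by blast
qed

lemma omega_act_left: "Vector_Spaces.linear sbms_scale omega_scale (\<lambda>x. omega_act lam \<alpha> h x v)"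
  unfolding omega_act_def by (rule linear_lift [OF vector_space_omega])

lemma omega_act_right: "Vector_Spaces.linear omega_scale omega_scale (omega_act lam \<alpha> h x)"
proof -
  note lin = basis_act_linear [unfolded linear_iff_module_hom]
  show ?thesis
    unfolding Vector_Spaces.linear_iff omega_act_def
    using vector_space_omega
    by (auto simp: module_hom.add [OF lin] module_hom.scale [OF lin] omega.scale_right_distrib
        sum.distrib omega.scale_sum_right mult.commute)
qed

lemmas act_linear =
  module_hom.add [OF omega_act_left [unfolded linear_iff_module_hom]]
  module_hom.add [OF omega_act_right [unfolded linear_iff_module_hom]]
  module_hom.scale [OF omega_act_left [unfolded linear_iff_module_hom]]
  module_hom.scale [OF omega_act_right [unfolded linear_iff_module_hom]]
  module_hom.zero [OF omega_act_left [unfolded linear_iff_module_hom]]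
  module_hom.zero [OF omega_act_right [unfolded linear_iff_module_hom]]
  module_hom.neg [OF omega_act_left [unfolded linear_iff_module_hom]]
  module_hom.neg [OF omega_act_right [unfolded linear_iff_module_hom]]
  module_hom.diff [OF omega_act_left [unfolded linear_iff_module_hom]]
  module_hom.diff [OF omega_act_right [unfolded linear_iff_module_hom]]

lemma omega_act_basis: "omega_act lam \<alpha> h (basis_elt b) v = basis_act lam \<alpha> h b v"
  by (simp add: omega_act_def)

lemma omega_act_single:
  "omega_act lam \<alpha> h (Poly_Mapping.single b c) v = omega_scale c (basis_act lam \<alpha> h b v)"
  by (subst single_eq_basis) (simp add: act_linear omega_act_basis)

lemma omega_act_central:
  "omega_act lam \<alpha> h (Poly_Mapping.single C1 c) v = 0"
  "omega_act lam \<alpha> h (Poly_Mapping.single C2 c) v = 0"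
  by (simp_all add: omega_act_single)

lemma basis_act_grade:
  "v \<in> omega_grade q \<Longrightarrow> basis_act lam \<alpha> h b v \<in> omega_grade (parity b + q)"
  by (cases b; cases q) (auto simp: omega_grade_def zero_prod_def split: if_splits)


lemma L_op_mult:
  assumes "deriv_t2 P = 1" "\<And>k. shift k P = P"
  shows "L_op \<alpha> p m (P * shift n f) =
    P * ((s_var + in_t2 p) * shift (m + n) f
      - of_int m * (in_t2 t2_var - of_int m * in_t2 [:\<alpha>:]) * deriv_t2 (shift (m + n) f))
    - of_int m * (in_t2 t2_var - of_int m * in_t2 [:\<alpha>:]) * shift (m + n) f"
proof -
  define X S where "X = in_t2 t2_var" and "S = s_var + in_t2 p"
  define A where "A = in_t2 [:\<alpha>:]"
  show ?thesis
    unfolding L_op_def X_def [symmetric] S_def [symmetric] A_def [symmetric]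
    by (simp add: assms algebra_simps)
qed

lemma half: "in_t2 [:1 / 2:] * 2 = 1"
  by (simp add: numeral_poly one_pCons)

lemma L_op_W:
  "L_op \<alpha> p m ((in_t2 t2_var - of_int n * in_t2 [:\<alpha>:]) * shift n f)
    - (in_t2 t2_var - of_int n * in_t2 [:\<alpha>:]) * shift n (L_op \<alpha> p m f)
    = of_int (n - m) * ((in_t2 t2_var - of_int (m + n) * in_t2 [:\<alpha>:]) * shift (m + n) f)"
proof -
  define X S where "X = in_t2 t2_var" and "S = s_var"
  define A P where "A = in_t2 [:\<alpha>:]" and "P = in_t2 p"
  have d: "deriv_t2 (in_t2 t2_var - of_int n * in_t2 [:\<alpha>:]) = 1"
    unfolding deriv_t2_simps by (simp add: pderiv_pCons one_pCons)
  have sh: "shift k (in_t2 t2_var - of_int n * in_t2 [:\<alpha>:])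
      = in_t2 t2_var - of_int n * in_t2 [:\<alpha>:]" for k
    unfolding shift_simps ..
  show ?thesis
    unfolding L_op_mult [OF d sh] L_op_shift unfolding
      X_def [symmetric] S_def [symmetric] A_def [symmetric] P_def [symmetric]
    by (simp add: algebra_simps)
qed

lemma L_op_G_even:
  "L_op \<alpha> (p - of_int m * [:1 / 2:]) m (shift n f) - shift n (L_op \<alpha> p m f)
    = (of_int n - of_int m * in_t2 [:1 / 2:]) * shift (m + n) f"
proof -
  define X S where "X = in_t2 t2_var" and "S = s_var"
  define A P H where "A = in_t2 [:\<alpha>:]" and "P = in_t2 p" and "H = in_t2 [:1 / 2:]"
  show ?thesis
    unfolding L_op_shift unfolding L_op_def in_t2_simps shift_shift
      X_def [symmetric] S_def [symmetric] A_def [symmetric] P_def [symmetric] H_def [symmetric]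
    by (simp add: algebra_simps)
qed

lemma L_op_G_odd:
  "L_op \<alpha> p m ((in_t2 t2_var - 2 * of_int n * in_t2 [:\<alpha>:]) * shift n f)
    - (in_t2 t2_var - 2 * of_int n * in_t2 [:\<alpha>:])
      * shift n (L_op \<alpha> (p - of_int m * [:1 / 2:]) m f)
    = (of_int n - of_int m * in_t2 [:1 / 2:])
      * ((in_t2 t2_var - 2 * of_int (m + n) * in_t2 [:\<alpha>:]) * shift (m + n) f)"
proof -
  define X S where "X = in_t2 t2_var" and "S = s_var"
  define A P H where "A = in_t2 [:\<alpha>:]" and "P = in_t2 p" and "H = in_t2 [:1 / 2:]"
  have two: "2 * of_int k * in_t2 [:\<alpha>:] = of_int (2 * k) * in_t2 [:\<alpha>:]" for k
    by (simp only: of_int_mult of_int_numeral)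
  have d: "deriv_t2 (in_t2 t2_var - 2 * of_int n * in_t2 [:\<alpha>:]) = 1"
    unfolding two deriv_t2_simps by (simp add: pderiv_pCons one_pCons)
  have sh: "shift k (in_t2 t2_var - 2 * of_int n * in_t2 [:\<alpha>:])
      = in_t2 t2_var - 2 * of_int n * in_t2 [:\<alpha>:]" for k
    unfolding two shift_simps ..
  have H: "H * (2 * x) = x" "H * (x * 2) = x" for x
    using half unfolding H_def [symmetric] by (metis mult.assoc mult.commute mult_1)+
  have H': "H * (a * (b * (2 * x))) = a * (b * x)" "H * (a * (b * (4 * x))) = a * (b * (2 * x))"
    for a b x
    using H(1) [of "a * (b * x)"] H(1) [of "a * (b * (2 * x))"] by (simp_all add: mult_ac)
  show ?thesis
    unfolding L_op_mult [OF d sh] L_op_shift unfolding in_t2_simps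
      X_def [symmetric] S_def [symmetric] A_def [symmetric] P_def [symmetric] H_def [symmetric]
    by (simp add: algebra_simps H H')
qed

lemma G_op_G_op:
  "(in_t2 t2_var - 2 * of_int m * in_t2 [:\<alpha>:]) * f
    + (in_t2 t2_var - 2 * of_int n * in_t2 [:\<alpha>:]) * f
    = 2 * ((in_t2 t2_var - of_int (m + n) * in_t2 [:\<alpha>:]) * f)"
proof -
  define X A where "X = in_t2 t2_var" and "A = in_t2 [:\<alpha>:]"
  show ?thesis
    unfolding X_def [symmetric] A_def [symmetric] by (simp add: algebra_simps)
qed

lemma h_poly_odd:
  fixes m n :: int and \<alpha> :: complex and h :: "complex poly"
  defines "H \<equiv> \<lambda>k. h_poly \<alpha> h k - of_int k * [:1 / 2:]"
  shows "of_int n * H n - of_int m * H m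
      - of_int m * (t2_var - of_int m * [:\<alpha>:]) * pderiv (H n)
      + of_int n * (t2_var - of_int n * [:\<alpha>:]) * pderiv (H m) = of_int (n - m) * H (m + n)"
proof -
  have d: "pderiv (H k) = pderiv (h_poly \<alpha> h k)" for k
    by (simp add: H_def pderiv_diff of_int_poly pderiv_pCons)
  define X A K where "X = t2_var" and "A = [:\<alpha>:]" and "K = [:1 / 2 :: complex:]"
  have K: "K * (2 * x) = x" "K * (x * 2) = x" for x
    by (simp_all add: K_def numeral_poly)
  show ?thesis
    using h_poly_identity [where n = n and m = m and \<alpha> = \<alpha> and h = h]
    unfolding d unfolding H_def X_def [symmetric] A_def [symmetric] K_def [symmetric]
    by (simp add: algebra_simps K)
qed

lemma basis_act_scale:
  "basis_act lam \<alpha> h b (omega_scale c v) = omega_scale c (basis_act lam \<alpha> h b v)"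
  by (rule module_hom.scale [OF basis_act_linear [unfolded linear_iff_module_hom]])

lemma smult_in_t2: "smult [:c:] f = in_t2 [:c:] * f"
  by simp

lemma int_const: "[:of_int k :: complex:] = of_int k"
  by (simp add: of_int_poly)

lemma act_bracket_basis_aux:
  assumes lam: "lam \<noteq> 0"
  shows "basis_act lam \<alpha> h (L m) (basis_act lam \<alpha> h (L n) (f, g))
    - basis_act lam \<alpha> h (L n) (basis_act lam \<alpha> h (L m) (f, g))
    = omega_scale (of_int (n - m)) (basis_act lam \<alpha> h (L (m + n)) (f, g))" (is ?LL)
  and "basis_act lam \<alpha> h (L m) (basis_act lam \<alpha> h (W n) (f, g))
    - basis_act lam \<alpha> h (W n) (basis_act lam \<alpha> h (L m) (f, g))
    = omega_scale (of_int (n - m)) (basis_act lam \<alpha> h (W (m + n)) (f, g))" (is ?LW)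
  and "basis_act lam \<alpha> h (L m) (basis_act lam \<alpha> h (G n) (f, g))
    - basis_act lam \<alpha> h (G n) (basis_act lam \<alpha> h (L m) (f, g))
    = omega_scale (of_int n - of_int m / 2) (basis_act lam \<alpha> h (G (m + n)) (f, g))" (is ?LG)
  and "basis_act lam \<alpha> h (G m) (basis_act lam \<alpha> h (G n) (f, g))
    + basis_act lam \<alpha> h (G n) (basis_act lam \<alpha> h (G m) (f, g))
    = omega_scale 2 (basis_act lam \<alpha> h (W (m + n)) (f, g))" (is ?GG)
  and "basis_act lam \<alpha> h (W m) (basis_act lam \<alpha> h (W n) (f, g))
    = basis_act lam \<alpha> h (W n) (basis_act lam \<alpha> h (W m) (f, g))" (is ?WW)
  and "basis_act lam \<alpha> h (W m) (basis_act lam \<alpha> h (G n) (f, g))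
    = basis_act lam \<alpha> h (G n) (basis_act lam \<alpha> h (W m) (f, g))" (is ?WG)
proof -
  have two: "2 * of_int k * in_t2 [:\<alpha>:] = of_int (2 * k) * in_t2 [:\<alpha>:]" for k
    by (simp only: of_int_mult of_int_numeral)
  have pow: "lam powi m * lam powi n = lam powi (m + n)" "lam powi n * lam powi m = lam powi (m + n)"
    using lam by (simp_all add: power_int_add mult.commute)
  have pull: "omega_scale (c * lam powi k) (u, v)
      = omega_scale (lam powi k) (in_t2 [:c:] * u, in_t2 [:c:] * v)" for c k u v
    by (simp add: mult.commute)
  have num: "[:2 :: complex:] = 2"
    by (simp add: numeral_poly)
  note simps = basis_act_simps basis_act_scale omega.scale_scale pow
    pull [where c = "of_int _"] pull [where c = "of_int _ - _"] pull [where c = 2]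
    omega.scale_right_diff_distrib [symmetric] omega.scale_right_distrib [symmetric]
    diff_Pair add_Pair int_const in_t2_simps shift_shift
  have half_const: "in_t2 [:of_int n - of_int m / 2:] = of_int n - of_int m * in_t2 [:1 / 2:]"
    by (simp add: of_int_poly)
  have two_simps: "shift k 2 = 2" "in_t2 2 = 2" for k
    by (simp_all add: shift_def numeral_poly)
  note comm = add.commute [of n m]
  show ?LL
    unfolding simps L_op_L_op [OF h_poly_identity] L_op_L_op [OF h_poly_odd] ..
  show ?LW
    unfolding simps L_op_W ..
  show ?LG
    unfolding simps L_op_G_even L_op_G_odd half_const ..
  show ?GG
    unfolding simps shift_simps shift_shift two_simps comm num
    using G_op_G_op [of m \<alpha> "shift (m + n) f" n]
      G_op_G_op [of n \<alpha> "shift (m + n) g" m]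
    by (simp only: two comm shift_simps)
  show ?WW
    unfolding simps shift_simps comm by (simp only: mult_ac)
  show ?WG
    unfolding simps shift_simps two_simps comm two by (simp only: mult_ac)
qed


lemma act_bracket_basis:
  assumes lam: "lam \<noteq> 0"
  shows "basis_act lam \<alpha> h a (basis_act lam \<alpha> h b v)
    - omega_scale (koszul_sign (parity a) (parity b))
        (basis_act lam \<alpha> h b (basis_act lam \<alpha> h a v))
    = omega_act lam \<alpha> h (basis_bracket a b) v"
proof (cases v)
  case (Pair f g)
  note aux = act_bracket_basis_aux [OF lam]
  have sym: "basis_act lam \<alpha> h b (basis_act lam \<alpha> h a v)
      - basis_act lam \<alpha> h a (basis_act lam \<alpha> h b v) = - x"
    if "basis_act lam \<alpha> h a (basis_act lam \<alpha> h b v)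
      - basis_act lam \<alpha> h b (basis_act lam \<alpha> h a v) = x" for a b v x
    using that by auto
  have zero: "basis_act lam \<alpha> h b 0 = 0" for b
    using basis_act_scale [of lam \<alpha> h b 0] by simp
  show ?thesis
    unfolding Pair
    by (cases a; cases b;
      simp add: koszul_sign_def act_linear omega_act_central omega_act_single zero aux
        sym [OF aux(2)] sym [OF aux(3)] add.commute
        del: basis_act.simps(1-3) omega_scale.simps)
qed

theorem lie_supermodule_omega:
  assumes "lam \<noteq> 0"
  shows "lie_supermodule sbms_scale sbms_grade sbms_bracket omega_scale omega_grade
    (omega_act lam \<alpha> h)"
proof (intro lie_supermodule.intro lie_supermodule_axioms.intro lie_superalgebra_sbms
    super_vector_space_omega omega_act_left omega_act_right)
  show "omega_act lam \<alpha> h x v \<in> omega_grade (p + q)"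
    if x: "x \<in> sbms_grade p" and v: "v \<in> omega_grade q" for x v p q
    using x
  proof (induction x rule: sbms_induct)
    case (single b c)
    have "basis_act lam \<alpha> h b v \<in> omega_grade (p + q)"
      using basis_act_grade [OF v, of lam \<alpha> h b] unfolding single .
    then show ?case
      by (simp only: act_linear omega_act_basis omega.subspace_scale omega.subspace_grade)
  qed (auto simp: act_linear omega.subspace_0 omega.subspace_add omega.subspace_grade)
  show "omega_act lam \<alpha> h x (omega_act lam \<alpha> h y v)
      - omega_scale (koszul_sign p q) (omega_act lam \<alpha> h y (omega_act lam \<alpha> h x v))
      = omega_act lam \<alpha> h (sbms_bracket x y) v"
    if x: "x \<in> sbms_grade p" and y: "y \<in> sbms_grade q" for x y v p q
    using x
  proof (induction x rule: sbms_induct)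
    case (single a c)
    from y show ?case
    proof (induction y rule: sbms_induct)
      case (single b d)
      then show ?case
        using act_bracket_basis [OF assms, of \<alpha> h a b v] \<open>parity a = p\<close>
        by (simp add: act_linear bracket_linear omega_act_basis bracket_basis mult_ac
            flip: act_bracket_basis [OF assms])
          (simp add: omega.scale_right_diff_distrib mult_ac)
    qed (auto simp: act_linear bracket_linear omega.scale_right_distrib algebra_simps)
  qed (auto simp: act_linear bracket_linear omega.scale_right_distrib algebra_simps)
qed


lemma coeff_pcompose_t2:
  "coeff (pcompose p [:0, 0, 1:]) n = (if even n then coeff p (n div 2) else 0)"
  for p :: "complex poly"
proof (induction p arbitrary: n)
  case (pCons c p)
  show ?case
  proof (cases "n < 2")
    case True
    then have "n = 0 \<or> n = 1" by auto
    then show ?thesis by (auto simp: pcompose_pCons coeff_pCons)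
  next
    case False
    then obtain k where "n = Suc (Suc k)"
      by (metis One_nat_def less_2_cases_iff not0_implies_Suc)
    then show ?thesis by (simp add: pcompose_pCons pCons)
  qed
qed simp

lemma bij_omega_poly:
  "bij (\<lambda>(f, g). map_poly (\<lambda>p. pcompose p [:0, 0, 1:]) f
    + [:[:0, 1:]:] * map_poly (\<lambda>p. pcompose p [:0, 0, 1:]) g
    :: complex poly poly)" (is "bij ?E")
proof -
  have coeff: "coeff (coeff (?E (f, g)) i) j =
      (if even j then coeff (coeff f i) (j div 2) else coeff (coeff g i) (j div 2))" for f g i j
    by (cases j) (auto simp: coeff_map_poly coeff_pcompose_t2 coeff_pCons poly_0_coeff_0)
  have "f = f' \<and> g = g'" if eq: "?E (f, g) = ?E (f', g')" for f g f' g'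
  proof (intro conjI poly_eqI)
    fix i k
    have *: "coeff (coeff (?E (f, g)) i) j = coeff (coeff (?E (f', g')) i) j" for j
      by (rule arg_cong [OF eq])
    show "coeff (coeff f i) k = coeff (coeff f' i) k"
      using * [of "2 * k"] unfolding coeff by simp
    show "coeff (coeff g i) k = coeff (coeff g' i) k"
      using * [of "2 * k + 1"] unfolding coeff by simp
  qed
  then have "inj ?E" by (intro injI; clarify; blast)
  moreover have "P \<in> range ?E" for P
  proof -
    define part where "part c p = (\<Sum>i\<le>degree p. monom (coeff p (2 * i + c)) i)"
      for c and p :: "complex poly"
    have part: "coeff (part c p) k = coeff p (2 * k + c)" for c p k
      by (auto simp: part_def coeff_sum coeff_eq_0)
    have part0: "part c 0 = 0" for c by (simp add: part_def)
    have "?E (map_poly (part 0) P, map_poly (part 1) P) = P"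
      by (intro poly_eqI)
        (simp only: coeff, auto simp: coeff_map_poly part0 part odd_two_times_div_two_succ)
    then show ?thesis by (rule range_eqI [OF sym])
  qed
  ultimately show ?thesis unfolding bij_def by (intro conjI UNIV_eq_I [symmetric])
qed

end

theory Submission
  imports Defs
begin

text \<open>
  Write \<open>x = t\<^sup>2\<close>, let \<open>U\<close> be a submodule, and let \<open>E\<close> and \<open>O\<close> be the sets of all \<open>f(x, s)\<close> with
  \<open>f \<in> U\<close> and \<open>t f \<in> U\<close> respectively. Since \<open>L\<^sub>0\<close> acts as multiplication by \<open>s\<close> and \<open>W\<^sub>0\<close> as
  multiplication by \<open>x\<close>, both are ideals of \<open>\<complex>[x, s]\<close>; this is \<open>graded_parts_ideals\<close>.

  Let \<open>\<alpha> \<noteq> 0\<close>. Any polynomial \<open>f\<close> is a scalar multiple of the difference of \<open>(x - a) f\<close>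
  and \<open>(x - b) f\<close> as soon as \<open>a \<noteq> b\<close>. The operators \<open>G\<^sub>m\<close> put the factor \<open>x - 2 m \<alpha>\<close> in front of a
  shift \<open>f(x, s - n)\<close> for different values of \<open>m\<close> with the same \<open>n\<close>, so this factor can be removed:
  \<open>E = O\<close>, and this ideal is invariant under all integer shifts of \<open>s\<close>
  (\<open>graded_parts_shift_invariant\<close>). Modulo such an ideal \<open>L\<^sub>m\<close> acts on \<open>f(x, s + m)\<close> as
  \<open>- m (x - m \<alpha>) \<partial>f/\<partial>x\<close> up to the factor \<open>\<lambda>\<^sup>m\<close>, and removing the linear factor once more shows
  invariance under \<open>\<partial>/\<partial>x\<close> (\<open>even_part_deriv_invariant\<close>). The polynomial \<open>h\<close> only enters through
  multiplication by \<open>s + h\<^sub>m\<close>, which maps every ideal into itself. Finally, a nonzero ideal invariant under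
  shifts and \<open>\<partial>/\<partial>x\<close> contains \<open>1\<close>: differences lower the degree in \<open>s\<close> and derivatives the degree in
  \<open>x\<close> until a nonzero constant is left (\<open>shift_deriv_invariant_ideal_eq_UNIV\<close>).

  For \<open>\<alpha> = 0\<close> every even operator that differentiates does so through \<open>x \<partial>/\<partial>x\<close>, and the odd operators
  enter the even part only with a factor \<open>x\<close>. Hence \<open>x \<complex>[x, s] \<oplus> t \<complex>[x, s]\<close> is a proper submodule
  (\<open>multiples_of_t2_invariant\<close>).
\<close>

section \<open>Ideals of polynomial rings\<close>

definition is_ideal :: "'a::comm_ring_1 set \<Rightarrow> bool"
  where "is_ideal I \<longleftrightarrow> (\<forall>f\<in>I. \<forall>g\<in>I. f + g \<in> I) \<and> (\<forall>p. \<forall>f\<in>I. p * f \<in> I)"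

lemma is_idealD:
  assumes "is_ideal I"
  shows "f \<in> I \<Longrightarrow> g \<in> I \<Longrightarrow> f + g \<in> I" and "f \<in> I \<Longrightarrow> p * f \<in> I"
    and "f \<in> I \<Longrightarrow> g \<in> I \<Longrightarrow> f - g \<in> I"
proof -
  show add: "f \<in> I \<Longrightarrow> g \<in> I \<Longrightarrow> f + g \<in> I" and mult: "f \<in> I \<Longrightarrow> p * f \<in> I" for f g p
    using assms by (auto simp: is_ideal_def)
  show "f \<in> I \<Longrightarrow> g \<in> I \<Longrightarrow> f - g \<in> I"
    using add [of f "- 1 * g"] mult [of g "- 1"] by simp
qed

text \<open>
  The constants and the two variables generate the ring, so it is enough to test these. In the
  module, the two variables act as \<open>L\<^sub>0\<close> and \<open>W\<^sub>0\<close>.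
\<close>
lemma is_ideal_poly_polyI:
  fixes I :: "'a::comm_ring_1 poly poly set"
  assumes zero: "0 \<in> I"
    and add: "\<And>f g. f \<in> I \<Longrightarrow> g \<in> I \<Longrightarrow> f + g \<in> I"
    and const: "\<And>c f. f \<in> I \<Longrightarrow> [:[:c:]:] * f \<in> I"
    and inner: "\<And>f. f \<in> I \<Longrightarrow> [:[:0, 1:]:] * f \<in> I"
    and outer: "\<And>f. f \<in> I \<Longrightarrow> [:0, 1:] * f \<in> I"
  shows "is_ideal I"
proof -
  have coeffs: "[:q:] * f \<in> I" if "f \<in> I" for q f
  proof (induction q)
    case 0
    then show ?case using zero by simp
  next
    case (pCons c q)
    have "[:pCons c q:] * f = [:[:c:]:] * f + [:[:0, 1:]:] * ([:q:] * f)"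
      by (simp add: smult_add_left [symmetric])
    then show ?case using add const inner that pCons.IH by presburger
  qed
  have "p * f \<in> I" if "f \<in> I" for p f
  proof (induction p)
    case 0
    then show ?case using zero by simp
  next
    case (pCons q p)
    have "pCons q p * f = [:q:] * f + [:0, 1:] * (p * f)"
      by simp
    then show ?case using add coeffs outer that pCons.IH by presburger
  qed
  then show ?thesis using add by (simp add: is_ideal_def)
qed

text \<open>
  The difference of the two multiples is \<open>(b - a) f\<close>, a unit times \<open>f\<close>.
\<close>
lemma ideal_cancel_linear_factors:
  fixes I :: "'a::field poly poly set"
  assumes I: "is_ideal I" and "a \<noteq> b"
    and "[:[:- a, 1:]:] * f \<in> I" "[:[:- b, 1:]:] * f \<in> I"
  shows "f \<in> I"
proof -
  have "[:[:1 / (b - a):]:] * ([:[:- a, 1:]:] * f - [:[:- b, 1:]:] * f) \<in> I"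
    using is_idealD(2) [OF I is_idealD(3) [OF I assms(3,4)]] .
  also have "[:[:- a, 1:]:] * f - [:[:- b, 1:]:] * f = [:[:b - a:]:] * f"
    by (simp add: smult_diff_left [symmetric])
  also have "[:[:1 / (b - a):]:] * ([:[:b - a:]:] * f) = f"
    using \<open>a \<noteq> b\<close> by (simp flip: one_pCons)
  finally show ?thesis .
qed

section \<open>Ideals invariant under shifts and derivatives\<close>

text \<open>A shift changes neither the degree in \<open>s\<close> nor the leading coefficient.\<close>
lemma degree_diff_shift_less:
  assumes "degree f > 0"
  shows "degree (f - shift m f) < degree f"
proof -
  have deg: "degree (shift m f) = degree f"
    by (simp add: shift_def degree_pcompose)
  have "coeff (shift m f) (degree f) = lead_coeff f"
    using lead_coeff_comp [of "[:- of_int m, 1:]" f] deg by (simp add: shift_def)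
  then have "coeff (f - shift m f) (degree f) = 0"
    by simp
  moreover have "degree (f - shift m f) \<le> degree f"
    using degree_diff_le [of f "degree f" "shift m f"] deg by simp
  ultimately show ?thesis
    using assms by (metis coeff_0_degree_minus_1 degree_0 diff_less
        leading_coeff_0_iff order_le_less zero_less_one)
qed

text \<open>
  If \<open>f(s - 1) = f(s)\<close>, then \<open>f - f(0)\<close> vanishes at every natural number, hence identically.
\<close>
lemma shift_fixed_imp_constant:
  assumes "shift 1 f = f"
  shows "degree f = 0"
proof -
  have step: "poly f (a - 1) = poly f a" for a
    using arg_cong [OF assms, of "\<lambda>p. poly p a"] by (simp add: shift_def poly_pcompose)
  have "poly f (of_nat n) = poly f 0" for n
    by (induction n) (use step [of "of_nat (Suc n)" for n] in simp_all)
  then have "range of_nat \<subseteq> {a. poly (f - [:poly f 0:]) a = 0}"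
    by auto
  then have "infinite {a. poly (f - [:poly f 0:]) a = 0}"
    using infinite_super [OF _ range_inj_infinite [OF inj_of_nat]] by blast
  then have "f - [:poly f 0:] = 0"
    using poly_roots_finite by blast
  then have "f = [:poly f 0:]"
    by simp
  then show ?thesis
    by (metis degree_pCons_0)
qed

text \<open>
  An element \<open>g \<noteq> 0\<close> of least degree in \<open>s\<close> must equal its own shift, because the difference lies
  in the ideal and has smaller degree; so \<open>g\<close> does not involve \<open>s\<close>. Among the elements of this kind
  one of least degree in \<open>x\<close> has derivative zero, so it is a unit.
\<close>
lemma shift_deriv_invariant_ideal_eq_UNIV:
  assumes I: "is_ideal I" and "f \<in> I" "f \<noteq> 0"
    and shift: "\<And>m f. f \<in> I \<Longrightarrow> shift m f \<in> I"
    and deriv: "\<And>f. f \<in> I \<Longrightarrow> deriv_t2 f \<in> I"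
  shows "I = UNIV"
proof -
  obtain g where g: "g \<in> I" "g \<noteq> 0" and g_min: "\<And>k. k \<in> I \<Longrightarrow> k \<noteq> 0 \<Longrightarrow> degree g \<le> degree k"
    using ex_has_least_nat [of "\<lambda>g. g \<in> I \<and> g \<noteq> 0" f degree] assms by blast
  have "degree g = 0"
  proof (rule ccontr)
    assume "degree g \<noteq> 0"
    then have "degree (g - shift 1 g) < degree g" "shift 1 g \<noteq> g"
      using degree_diff_shift_less shift_fixed_imp_constant by auto
    moreover have "g - shift 1 g \<in> I"
      using I g shift by (intro is_idealD)
    ultimately show False
      using g_min [of "g - shift 1 g"] by auto
  qed
  then obtain q where "in_t2 q \<in> I" "q \<noteq> 0"
    using g by (metis degree_0_id pCons_0_0 of_nat_0 degree_eq_zeroE)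
  then obtain q where q: "in_t2 q \<in> I" "q \<noteq> 0"
    and q_min: "\<And>r. in_t2 r \<in> I \<Longrightarrow> r \<noteq> 0 \<Longrightarrow> degree q \<le> degree r"
    using ex_has_least_nat [of "\<lambda>q. in_t2 q \<in> I \<and> q \<noteq> 0" q degree] by blast
  have "in_t2 (pderiv q) \<in> I"
    using deriv [OF q(1)] by simp
  then have "degree q = 0"
    using q_min [of "pderiv q"] by (cases "degree q = 0") (auto simp: pderiv_eq_0_iff degree_pderiv)
  then obtain c where c: "q = [:c:]" "c \<noteq> 0"
    using q by (metis degree_eq_zeroE pCons_0_0)
  have "k \<in> I" for k
    using is_idealD(2) [OF I q(1), of "k * in_t2 [:1 / c:]"] c by (simp flip: one_pCons)
  then show ?thesis by blast
qed

section \<open>Submodules as pairs of ideals\<close>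

text \<open>This disposes of the factors \<open>\<lambda>\<^sup>m\<close>.\<close>
lemma subspace_scale_cancel:
  assumes "omega.subspace U" "c \<noteq> 0" "omega_scale c v \<in> U"
  shows "v \<in> U"
  using omega.subspace_scale [OF assms(1,3), of "1 / c"] assms(2) by simp

lemma graded_parts_ideals:
  assumes U: "omega.subspace U" and act: "\<forall>b. \<forall>v\<in>U. basis_act lam \<alpha> h b v \<in> U"
  shows "is_ideal {f. (f, 0) \<in> U}" and "is_ideal {g. (0, g) \<in> U}"
proof -
  have zero: "(0, 0) \<in> U"
    using omega.subspace_0 [OF U] by (simp add: zero_prod_def)
  have add: "(f + f', g + g') \<in> U" if "(f, g) \<in> U" "(f', g') \<in> U" for f g f' g'
    using omega.subspace_add [OF U that] by simp
  have const: "(in_t2 [:c:] * f, in_t2 [:c:] * g) \<in> U" if "(f, g) \<in> U" for c f g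
    using omega.subspace_scale [OF U that, of c] by simp
  have shift0: "shift 0 f = f" for f
    by (simp add: shift_def)
  have W0: "(in_t2 t2_var * f, in_t2 t2_var * g) \<in> U" if "(f, g) \<in> U" for f g
    using act [rule_format, OF that, of "W 0"] by (simp add: shift0 flip: one_pCons)
  have L0: "(s_var * f, s_var * g) \<in> U" if "(f, g) \<in> U" for f g
    using act [rule_format, OF that, of "L 0"] by (simp add: shift0 h_poly_def flip: one_pCons)
  show "is_ideal {f. (f, 0) \<in> U}"
    by (rule is_ideal_poly_polyI; unfold mem_Collect_eq)
      (use zero add [of _ 0 _ 0] const [of _ 0] W0 [of _ 0] L0 [of _ 0] in simp_all)
  show "is_ideal {g. (0, g) \<in> U}"
    by (rule is_ideal_poly_polyI; unfold mem_Collect_eq)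
      (use zero add [of 0 _ 0] const [of 0] W0 [of 0] L0 [of 0] in simp_all)
qed

text \<open>
  For \<open>f \<in> E\<close>, going to \<open>O\<close> and back by \<open>G\<^sub>k\<close> and \<open>G\<^sub>j\<close> gives \<open>(x - 2 j \<alpha>) f(x, s - j - k) \<in> E\<close>. With
  \<open>j + k\<close> kept fixed, \<open>j = 0\<close> and \<open>j = 1\<close> yield two different linear factors precisely when \<open>\<alpha> \<noteq> 0\<close>, so
  the shift itself is in \<open>E\<close>. For \<open>g \<in> O\<close>, one application of \<open>G\<^sub>j\<close> gives \<open>(x - 2 j \<alpha>) g(x, s - j) \<in> E\<close>;
  undoing the shift inside \<open>E\<close> makes the values \<open>j = 0\<close> and \<open>j = 1\<close> comparable in the same way.
\<close>
lemma graded_parts_shift_invariant: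
  assumes U: "omega.subspace U" and act: "\<forall>b. \<forall>v\<in>U. basis_act lam \<alpha> h b v \<in> U"
    and "lam \<noteq> 0" "\<alpha> \<noteq> 0"
  shows "(f, 0) \<in> U \<Longrightarrow> (shift m f, 0) \<in> U" and "(0, g) \<in> U \<longleftrightarrow> (g, 0) \<in> U"
proof -
  note ideal = graded_parts_ideals [OF U act]
  have lam: "lam powi m \<noteq> 0" for m
    using \<open>lam \<noteq> 0\<close> by simp
  have G: "(in_t2 [:- (2 * of_int m * \<alpha>), 1:] * shift m g, shift m f) \<in> U" if "(f, g) \<in> U" for f g m
    by (rule subspace_scale_cancel [OF U lam [of m]])
      (use act [rule_format, OF that, of "G m"] in \<open>simp del: omega_scale.simps\<close>)
  have even_odd: "(0, shift m f) \<in> U" if "(f, 0) \<in> U" for f m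
    using G [OF that, of m] by simp
  have odd_even: "(in_t2 [:- (2 * of_int m * \<alpha>), 1:] * shift m g, 0) \<in> U" if "(0, g) \<in> U" for g m
    using G [OF that, of m] by simp
  have cancel_even: "(f, 0) \<in> U"
    if "(in_t2 [:- (2 * of_int 0 * \<alpha>), 1:] * f, 0) \<in> U"
      "(in_t2 [:- (2 * of_int 1 * \<alpha>), 1:] * f, 0) \<in> U" for f
    using ideal_cancel_linear_factors [OF ideal(1), of "2 * of_int 0 * \<alpha>" "2 * of_int 1 * \<alpha>" f]
      that \<open>\<alpha> \<noteq> 0\<close>
    by simp
  show shift_even: "(shift m f, 0) \<in> U" if "(f, 0) \<in> U" for f m
  proof (rule cancel_even)
    show "(in_t2 [:- (2 * of_int 0 * \<alpha>), 1:] * shift m f, 0) \<in> U"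
      using odd_even [OF even_odd [OF that, of m], of 0] unfolding shift_shift by simp
    show "(in_t2 [:- (2 * of_int 1 * \<alpha>), 1:] * shift m f, 0) \<in> U"
      using odd_even [OF even_odd [OF that, of "m - 1"], of 1] unfolding shift_shift by simp
  qed
  have shift0: "shift 0 f = f" for f
    by (simp add: shift_def)
  have "(g, 0) \<in> U" if "(0, g) \<in> U"
  proof (rule cancel_even)
    show "(in_t2 [:- (2 * of_int 0 * \<alpha>), 1:] * g, 0) \<in> U"
      using odd_even [OF that, of 0] shift0 by simp
    show "(in_t2 [:- (2 * of_int 1 * \<alpha>), 1:] * g, 0) \<in> U"
      using shift_even [OF odd_even [OF that, of 1], of "- 1"]
      unfolding shift_simps shift_shift by (simp add: shift0)
  qed
  moreover have "(0, g) \<in> U" if "(g, 0) \<in> U"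
    using even_odd [OF that, of 0] shift0 by simp
  ultimately show "(0, g) \<in> U \<longleftrightarrow> (g, 0) \<in> U" by blast
qed

text \<open>
  Applying \<open>L\<^sub>m\<close> to \<open>f(x, s + m)\<close> and subtracting the multiple \<open>(s + h\<^sub>m) f\<close> leaves
  \<open>m (x - m \<alpha>) \<partial>f/\<partial>x\<close> up to sign. The values \<open>m = 1\<close> and \<open>m = - 1\<close> give the distinct linear factors
  \<open>x - \<alpha>\<close> and \<open>x + \<alpha>\<close>, with coefficients \<open>\<plusminus> 1\<close>.
\<close>
lemma even_part_deriv_invariant:
  assumes U: "omega.subspace U" and act: "\<forall>b. \<forall>v\<in>U. basis_act lam \<alpha> h b v \<in> U"
    and "lam \<noteq> 0" "\<alpha> \<noteq> 0" and f: "(f, 0) \<in> U"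
  shows "(deriv_t2 f, 0) \<in> U"
proof -
  define I where "I = {f. (f, 0) \<in> U}"
  have I: "is_ideal I"
    unfolding I_def by (rule graded_parts_ideals [OF U act])
  have L: "in_t2 [:- (of_int m * \<alpha>), 1:] * (of_int m * deriv_t2 f) \<in> I" for m
  proof -
    let ?p = "s_var + in_t2 (h_poly \<alpha> h m)"
    let ?D = "in_t2 [:- (of_int m * \<alpha>), 1:] * (of_int m * deriv_t2 f)"
    have preimage: "(shift (- m) f, 0) \<in> U"
      by (rule graded_parts_shift_invariant(1) [OF U act \<open>lam \<noteq> 0\<close> \<open>\<alpha> \<noteq> 0\<close> f])
    have "L_op \<alpha> (h_poly \<alpha> h m) m (shift (- m) f) \<in> I"
      unfolding I_def mem_Collect_eq
      by (rule subspace_scale_cancel [OF U, of "lam powi m"])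
        (use act [rule_format, OF preimage, of "L m"] \<open>lam \<noteq> 0\<close> in
          \<open>simp_all add: basis_act_simps L_op_def del: basis_act.simps(1-3) omega_scale.simps\<close>)
    also have "L_op \<alpha> (h_poly \<alpha> h m) m (shift (- m) f) = ?p * f - ?D"
    proof -
      have "in_t2 t2_var - of_int m * in_t2 [:\<alpha>:] = in_t2 [:- (of_int m * \<alpha>), 1:]"
        by (simp add: of_int_poly)
      moreover have "shift m (shift (- m) f) = f"
        unfolding shift_shift by (simp add: shift_def)
      ultimately show ?thesis
        unfolding L_op_def by (simp only: mult_ac)
    qed
    finally have diff: "?p * f - ?D \<in> I" .
    have "?p * f \<in> I"
      using f by (intro is_idealD(2) [OF I]) (simp add: I_def)
    from is_idealD(3) [OF I this diff] show ?thesis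
      by (simp only: diff_diff_eq2 add_diff_cancel_left')
  qed
  have "in_t2 [:- \<alpha>, 1:] * deriv_t2 f \<in> I"
    using L [of 1] by simp
  moreover have "in_t2 [:- (- \<alpha>), 1:] * deriv_t2 f \<in> I"
    using is_idealD(2) [OF I L [of "- 1"], of "- 1"] by simp
  ultimately have "deriv_t2 f \<in> I"
    using ideal_cancel_linear_factors [OF I, of \<alpha> "- \<alpha>"] \<open>\<alpha> \<noteq> 0\<close> by simp
  then show ?thesis by (simp add: I_def)
qed

section \<open>The simplicity criterion\<close>

text \<open>
  If \<open>x\<close> divides \<open>f\<close>, then it divides all shifts of \<open>f\<close>. The terms with \<open>\<partial>f/\<partial>x\<close> in \<open>L\<^sub>m\<close> carry the
  factor \<open>x - m \<alpha>\<close> and the odd component enters through \<open>G\<^sub>m\<close> with the factor \<open>x - 2 m \<alpha>\<close>; both factors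
  become \<open>x\<close> for \<open>\<alpha> = 0\<close>.
\<close>
lemma multiples_of_t2_invariant:
  assumes "in_t2 t2_var dvd fst v"
  shows "in_t2 t2_var dvd fst (basis_act lam 0 h b v)"
proof (cases v)
  case (Pair f g)
  then obtain k where k: "f = in_t2 t2_var * k"
    using assms by (auto elim: dvdE)
  have shift: "in_t2 t2_var dvd shift m f" for m
    unfolding k shift_simps by (rule dvd_triv_left)
  have factor: "in_t2 t2_var dvd of_int m * (in_t2 t2_var - of_int m * in_t2 [:0:])" for m
    by (rule dvd_mult) simp
  have "in_t2 t2_var dvd L_op 0 p m f" for p m
    unfolding L_op_def by (rule dvd_diff [OF dvd_mult [OF shift] dvd_mult2 [OF factor]])
  moreover have "in_t2 t2_var dvd smult [:0, c:] p" for c p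
    using dvd_triv_left [of "in_t2 t2_var" "smult [:c:] p"] by simp
  ultimately show ?thesis
    unfolding Pair by (cases b) (auto simp: basis_act_simps dvd_smult simp del: basis_act.simps(1-3))
qed

theorem theorem2p4:
  fixes lam \<alpha> :: complex and h :: "complex poly"
  assumes "lam \<noteq> 0"
  shows "simple_lie_supermodule sbms_scale sbms_grade sbms_bracket
      omega_scale omega_grade (omega_act lam \<alpha> h) \<longleftrightarrow> \<alpha> \<noteq> 0"
proof -
  interpret M: lie_supermodule sbms_scale sbms_grade sbms_bracket omega_scale omega_grade
      "omega_act lam \<alpha> h"
    using assms by (rule lie_supermodule_omega)
  show ?thesis
  proof
    assume simple: "simple_lie_supermodule sbms_scale sbms_grade sbms_bracket
      omega_scale omega_grade (omega_act lam \<alpha> h)"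
    show "\<alpha> \<noteq> 0"
    proof
      assume "\<alpha> = 0"
      define U :: "omega set" where "U = {v. in_t2 t2_var dvd fst v}"
      have subspace: "omega.subspace U"
        by (rule omega.subspaceI) (auto simp: U_def dvd_smult)
      have "omega_act lam \<alpha> h x u \<in> U" if "u \<in> U" for x u
        unfolding omega_act_def
        by (intro omega.subspace_sum [OF subspace] omega.subspace_scale [OF subspace])
          (use that multiples_of_t2_invariant \<open>\<alpha> = 0\<close> in \<open>auto simp: U_def\<close>)
      moreover have "\<exists>u0\<in>U \<inter> omega_grade 0. \<exists>u1\<in>U \<inter> omega_grade 1. u = u0 + u1"
        if "u \<in> U" for u
        using that
        by (intro bexI [of _ "(fst u, 0)"] bexI [of _ "(0, snd u)"])
          (auto simp: U_def omega_grade_def)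
      ultimately have "M.submodule U"
        using subspace by (auto simp: M.submodule_def)
      then have "U = {0} \<or> U = UNIV"
        by (rule simple_lie_supermodule.no_proper_submodule [OF simple])
      moreover have "(0, 1) \<in> U" "(0, 1) \<noteq> (0 :: omega)"
        by (auto simp: U_def zero_prod_def)
      moreover have "(1, 0) \<notin> U"
        by (auto simp: U_def is_unit_const_poly_iff is_unit_pCons_iff)
      ultimately show False by blast
    qed
  next
    assume "\<alpha> \<noteq> 0"
    have "U = {0} \<or> U = UNIV" if "M.submodule U" for U
    proof (cases "U = {0}")
      case False
      have subspace: "omega.subspace U"
        and act: "\<forall>b. \<forall>u\<in>U. basis_act lam \<alpha> h b u \<in> U"
        using \<open>M.submodule U\<close> unfolding M.submodule_def omega_act_basis [symmetric] by blast+
      note shift = graded_parts_shift_invariant [OF subspace act assms \<open>\<alpha> \<noteq> 0\<close>]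
        and deriv = even_part_deriv_invariant [OF subspace act assms \<open>\<alpha> \<noteq> 0\<close>]
      have "\<exists>v\<in>U. v \<noteq> 0"
        using False omega.subspace_0 [OF subspace] by blast
      then obtain f g where "(f, g) \<in> U" "(f, g) \<noteq> 0"
        by (metis surj_pair)
      moreover from this have "(f, 0) \<in> U" "(0, g) \<in> U"
        using \<open>M.submodule U\<close> unfolding M.submodule_def omega_grade_def by fastforce+
      ultimately obtain k where k: "(k, 0) \<in> U" "k \<noteq> 0"
        using shift(2) by (auto simp: zero_prod_def)
      have "{f. (f, 0) \<in> U} = UNIV"
        by (rule shift_deriv_invariant_ideal_eq_UNIV [of _ k])
          (use k shift deriv graded_parts_ideals(1) [OF subspace act] in simp_all)
      then have "(f, 0) \<in> U" "(0, f) \<in> U" for f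
        using shift(2) by auto
      then have "(f, g) \<in> U" for f g
        using omega.subspace_add [OF subspace, of "(f, 0)" "(0, g)"] by simp
      then show ?thesis by auto
    qed simp
    moreover have "(1, 0) \<noteq> (0 :: omega)"
      by (simp add: zero_prod_def)
    ultimately show "simple_lie_supermodule sbms_scale sbms_grade sbms_bracket
        omega_scale omega_grade (omega_act lam \<alpha> h)"
      by unfold_locales blast+
  qed
qed

end
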